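(* Let $\mathbb F$ be a field of characteristic $p\ge3$, let $(L,[\cdot,\cdot],(\cdot)^{[p]})$ be a restricted Lie algebra over $\mathbb F$, let $n\ge1$, let $(m_t^n,\omega_t^n)$, $m^n_t=\sum_{i=0}^nt^im_i$, $\omega^n_t=\sum_{i=0}^nt^i\omega_i$, be an $n$-order deformation of $L$ and let $(m_{n+1},\omega_{n+1})\in C^2_*(L,L)$. Suppose that $(m_t^n+t^{n+1}m_{n+1},\ \omega_t^n+t^{n+1}\omega_{n+1})$ is an $(n+1)$-order deformation of $L$. Then $$\big(\mathrm{obs}^{(1)}_{n+1},\mathrm{obs}^{(2)}_{n+1}\big)=d^2_*(m_{n+1},\omega_{n+1}),$$ where for $x,y,z\in L$ $$\mathrm{obs}^{(1)}_{n+1}(x,y,z)=-\sum_{i=1}^n\big(m_i(x,m_{n+1-i}(y,z))+m_i(y,m_{n+1-i}(z,x))+m_i(z,m_{n+1-i}(x,y))\big),$$ $$\mathrm{obs}^{(2)}_{n+1}(x,y)=\sum_{i=1}^n m_i(x,\omega_{n+1-i}(y))-\sum_{\substack{0\le i_k\le n\\ i_1+\cdots+i_p=n+1}}m_{i_p}\big(m_{i_{p-1}}(\cdots m_{i_1}(x,y),\cdots,y),y\big).$$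
   Context: Restricted Lie algebra over a field $\mathbb F$ of characteristic $p$: a Lie algebra $L$ with a map $(\cdot)^{[p]}:L\to L$ such that $(\lambda x)^{[p]}=\lambda^p x^{[p]}$; $[x,y^{[p]}]=[[\cdots[x,y],y],\cdots,y]$ ($p$ copies of $y$); $(x+y)^{[p]}=x^{[p]}+y^{[p]}+\sum_{i=1}^{p-1}s_i(x,y)$, where $i\,s_i(x,y)$ is the coefficient of $Z^{i-1}$ in $\mathrm{ad}^{p-1}_{Zx+y}(x)$. Notation: $[x_1,\dots,x_n]:=[[\cdots[x_1,x_2],x_3],\cdots,x_n]$. $L$ acts on itself by $x\cdot m=[x,m]$. $C^n_{CE}(L,L)$ is the space of alternating $n$-linear maps $L^n\to L$, and $d^2_{CE}\varphi(x,y,z)=-\varphi([x,y],z)+\varphi([x,z],y)-\varphi([y,z],x)+[x,\varphi(y,z)]-[y,\varphi(x,z)]+[z,\varphi(x,y)]$. $C^2_*(L,L)$ is the set of pairs $(\varphi,\omega)$ with $\varphi\in C^2_{CE}(L,L)$ and $\omega:L\to L$ a map having the $( * )$-property with respect to $\varphi$: $\omega(\lambda x)=\lambda^p\omega(x)$ and $$\omega(x+y)=\omega(x)+\omega(y)+\sum_{\substack{x_i\in\{x,y\}\\ x_1=x,\ x_2=y}}\frac1{\sharp\{x\}}\sum_{k=0}^{p-2}(-1)^k\,x_p\cdot x_{p-1}\cdots x_{p-k+1}\cdot\varphi([x_1,\dots,x_{p-k-1}],x_{p-k}),$$ where the outer sum is over $p$-tuples of symbols in $\{x,y\}$ with $x_1=x,x_2=y$,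 and $\sharp\{x\}$ is the number of $x_i$ equal to $x$. For $(\alpha,\beta)\in C^2_*(L,L)$, $d^2_*(\alpha,\beta)=(d^2_{CE}\alpha,\mathrm{ind}^2(\alpha,\beta))$ with $\mathrm{ind}^2(\alpha,\beta)(x,y)=-\alpha(x,y^{[p]})+\sum_{i+j=p-1}(-1)^i\,\mathrm{ad}_y^i\big(\alpha([x,\underbrace{y,\dots,y}_{j}],y)\big)-[x,\beta(y)]$. An $n$-order deformation of $L$ is a pair $m_t^n=\sum_{i=0}^nt^im_i$, $\omega_t^n=\sum_{i=0}^nt^i\omega_i$ with $m_0=[\cdot,\cdot]$, $\omega_0=(\cdot)^{[p]}$, $(m_i,\omega_i)\in C^2_*(L,L)$ for $1\le i\le n$, such that ($m^n_t$ being extended bilinearly in $t$) for all $x,y,z\in L$, modulo $t^{n+1}$: $m^n_t(x,m^n_t(y,z))+m^n_t(y,m^n_t(z,x))+m^n_t(z,m^n_t(x,y))=0$ and $m^n_t(x,\omega^n_t(y))=m^n_t(m^n_t(\cdots m^n_t(x,y),y),\cdots,y)$ ($p$ copies of $y$). *)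

theory Defs
  imports "HOL-Computational_Algebra.Computational_Algebra"
begin

text \<open>
  The vector space \<open>L\<close> is a type \<open>'l\<close> with scalar multiplication \<open>scale :: 'f \<Rightarrow> 'l \<Rightarrow> 'l\<close>.
  \<open>L[t]\<close> is the type \<open>'l poly\<close>; \<open>L\<close> sits in it as the constant polynomials \<open>[:x:]\<close>, and
  multiplication by \<open>t\<close> is \<open>pCons 0\<close>.
\<close>

definition C2_CE :: "('f::field \<Rightarrow> 'l::ab_group_add \<Rightarrow> 'l) \<Rightarrow> ('l \<Rightarrow> 'l \<Rightarrow> 'l) set" where
  "C2_CE scale = {\<phi>. (\<forall>x. Vector_Spaces.linear scale scale (\<phi> x)) \<and>
                     (\<forall>y. Vector_Spaces.linear scale scale (\<lambda>x. \<phi> x y)) \<and>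
                     (\<forall>x. \<phi> x x = 0)}"

text \<open>\<open>lnorm b [x\<^sub>1, \<dots>, x\<^sub>n] = b (\<dots> (b (b x\<^sub>1 x\<^sub>2) x\<^sub>3) \<dots>) x\<^sub>n\<close>; only used for \<open>n \<ge> 1\<close>.\<close>

definition lnorm :: "('a \<Rightarrow> 'a \<Rightarrow> 'a) \<Rightarrow> 'a list \<Rightarrow> 'a" where
  "lnorm b xs = foldl b (hd xs) (tl xs)"

text \<open>The extension of a biadditive map on \<open>L\<close> to \<open>L[t]\<close> that is bilinear in \<open>t\<close>.\<close>

definition bilin_ext :: "('l \<Rightarrow> 'l \<Rightarrow> 'l) \<Rightarrow> 'l poly \<Rightarrow> 'l poly \<Rightarrow> 'l::ab_group_add poly" where
  "bilin_ext b P Q =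
     (\<Sum>j\<le>degree P. \<Sum>k\<le>degree Q. monom (b (coeff P j) (coeff Q k)) (j + k))"

locale lie_algebra = vector_space scale
  for scale :: "'f::field \<Rightarrow> 'l::ab_group_add \<Rightarrow> 'l" +
  fixes br :: "'l \<Rightarrow> 'l \<Rightarrow> 'l"
  assumes bracket: "br \<in> C2_CE scale"
    and jacobi: "br x (br y z) + br y (br z x) + br z (br x y) = 0"

text \<open>
  \<open>s\<^sub>i(x,y)\<close>: \<open>i\<close> times it is the coefficient of \<open>Z\<^bsup>i-1\<^esup>\<close> in \<open>ad\<^bsub>Zx+y\<^esub>\<^bsup>p-1\<^esup>(x)\<close>,
  computed in \<open>L[Z]\<close>; the polynomial \<open>Zx + y\<close> is \<open>[:y, x:]\<close>.
\<close>

definition jacobson_s ::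
  "nat \<Rightarrow> ('f::field \<Rightarrow> 'l::ab_group_add \<Rightarrow> 'l) \<Rightarrow> ('l \<Rightarrow> 'l \<Rightarrow> 'l) \<Rightarrow> nat \<Rightarrow> 'l \<Rightarrow> 'l \<Rightarrow> 'l" where
  "jacobson_s p scale br i x y =
     scale (1 / of_nat i) (coeff ((bilin_ext br [:y, x:] ^^ (p - 1)) [:x:]) (i - 1))"

locale restricted_lie_algebra = lie_algebra scale br
  for p :: nat
    and scale :: "'f::field \<Rightarrow> 'l::ab_group_add \<Rightarrow> 'l"
    and br :: "'l \<Rightarrow> 'l \<Rightarrow> 'l" +
  fixes pm :: "'l \<Rightarrow> 'l"
  assumes prime_p: "prime p"
    and char_p: "CHAR('f) = p"
    and pm_scale: "pm (scale c x) = scale (c ^ p) (pm x)"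
    and br_pm: "br x (pm y) = lnorm br (x # replicate p y)"
    and pm_add: "pm (x + y) = pm x + pm y + (\<Sum>i=1..p-1. jacobson_s p scale br i x y)"

text \<open>
  A tuple of symbols in \<open>{x,y}\<close> is a word \<open>w\<close> over \<open>bool\<close>, with \<open>True\<close> for \<open>x\<close> and
  \<open>False\<close> for \<open>y\<close>, so that \<open>x\<close> and \<open>y\<close> stay distinct as symbols even if they are the same
  element. Lists are indexed from \<open>0\<close>: \<open>x\<^sub>i\<close> is \<open>v ! (i - 1)\<close>, and
  \<open>drop (p - k) v = [x\<^bsub>p-k+1\<^esub>, \<dots>, x\<^sub>p]\<close>, along which \<open>fold br\<close> applies
  \<open>x\<^bsub>p-k+1\<^esub>\<close> first and \<open>x\<^sub>p\<close> last.
\<close>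

definition star_words :: "nat \<Rightarrow> bool list set" where
  "star_words p = {w. length w = p \<and> w ! 0 \<and> \<not> w ! 1}"

definition star_term ::
  "nat \<Rightarrow> ('f::field \<Rightarrow> 'l::ab_group_add \<Rightarrow> 'l) \<Rightarrow> ('l \<Rightarrow> 'l \<Rightarrow> 'l) \<Rightarrow> ('l \<Rightarrow> 'l \<Rightarrow> 'l)
     \<Rightarrow> 'l list \<Rightarrow> 'l" where
  "star_term p scale br \<phi> v =
     (\<Sum>k=0..p-2. scale ((- 1) ^ k)
        (fold br (drop (p - k) v) (\<phi> (lnorm br (take (p - k - 1) v)) (v ! (p - k - 1)))))"

definition star_property ::
  "nat \<Rightarrow> ('f::field \<Rightarrow> 'l::ab_group_add \<Rightarrow> 'l) \<Rightarrow> ('l \<Rightarrow> 'l \<Rightarrow> 'l) \<Rightarrow> ('l \<Rightarrow> 'l \<Rightarrow> 'l)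
     \<Rightarrow> ('l \<Rightarrow> 'l) \<Rightarrow> bool" where
  "star_property p scale br \<phi> \<omega> \<longleftrightarrow>
     (\<forall>c x. \<omega> (scale c x) = scale (c ^ p) (\<omega> x)) \<and>
     (\<forall>x y. \<omega> (x + y) = \<omega> x + \<omega> y +
        (\<Sum>w\<in>star_words p. scale (1 / of_nat (count_list w True))
           (star_term p scale br \<phi> (map (\<lambda>s. if s then x else y) w))))"

definition C2_star ::
  "nat \<Rightarrow> ('f::field \<Rightarrow> 'l::ab_group_add \<Rightarrow> 'l) \<Rightarrow> ('l \<Rightarrow> 'l \<Rightarrow> 'l)
     \<Rightarrow> (('l \<Rightarrow> 'l \<Rightarrow> 'l) \<times> ('l \<Rightarrow> 'l)) set" where
  "C2_star p scale br = {(\<phi>, \<omega>). \<phi> \<in> C2_CE scale \<and> star_property p scale br \<phi> \<omega>}"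

definition d2_CE ::
  "('l::ab_group_add \<Rightarrow> 'l \<Rightarrow> 'l) \<Rightarrow> ('l \<Rightarrow> 'l \<Rightarrow> 'l) \<Rightarrow> 'l \<Rightarrow> 'l \<Rightarrow> 'l \<Rightarrow> 'l" where
  "d2_CE br \<phi> x y z =
     - \<phi> (br x y) z + \<phi> (br x z) y - \<phi> (br y z) x
     + br x (\<phi> y z) - br y (\<phi> x z) + br z (\<phi> x y)"

definition ind2 ::
  "nat \<Rightarrow> ('f::field \<Rightarrow> 'l::ab_group_add \<Rightarrow> 'l) \<Rightarrow> ('l \<Rightarrow> 'l \<Rightarrow> 'l) \<Rightarrow> ('l \<Rightarrow> 'l)
     \<Rightarrow> ('l \<Rightarrow> 'l \<Rightarrow> 'l) \<times> ('l \<Rightarrow> 'l) \<Rightarrow> 'l \<Rightarrow> 'l \<Rightarrow> 'l" where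
  "ind2 p scale br pm = (\<lambda>(\<alpha>, \<beta>) x y.
     - \<alpha> x (pm y)
     + (\<Sum>(i, j) | i + j = p - 1.
          scale ((- 1) ^ i) ((br y ^^ i) (\<alpha> (lnorm br (x # replicate j y)) y)))
     - br x (\<beta> y))"

definition d2_star ::
  "nat \<Rightarrow> ('f::field \<Rightarrow> 'l::ab_group_add \<Rightarrow> 'l) \<Rightarrow> ('l \<Rightarrow> 'l \<Rightarrow> 'l) \<Rightarrow> ('l \<Rightarrow> 'l)
     \<Rightarrow> ('l \<Rightarrow> 'l \<Rightarrow> 'l) \<times> ('l \<Rightarrow> 'l)
     \<Rightarrow> ('l \<Rightarrow> 'l \<Rightarrow> 'l \<Rightarrow> 'l) \<times> ('l \<Rightarrow> 'l \<Rightarrow> 'l)" where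
  "d2_star p scale br pm c = (d2_CE br (fst c), ind2 p scale br pm c)"

text \<open>
  A truncated family \<open>m\<^sub>0, \<dots>, m\<^sub>n\<close> is a function on \<open>nat\<close> of which only the values at
  \<open>0, \<dots>, n\<close> are used; \<open>mt n m\<close> is \<open>\<Sum>\<^sub>i t\<^sup>i m\<^sub>i\<close> extended to \<open>L[t]\<close>.
\<close>

definition mt :: "nat \<Rightarrow> (nat \<Rightarrow> 'l \<Rightarrow> 'l \<Rightarrow> 'l) \<Rightarrow> 'l poly \<Rightarrow> 'l poly \<Rightarrow> 'l::ab_group_add poly" where
  "mt n m P Q = (\<Sum>i\<le>n. (pCons 0 ^^ i) (bilin_ext (m i) P Q))"

definition \<omega>t :: "nat \<Rightarrow> (nat \<Rightarrow> 'l \<Rightarrow> 'l) \<Rightarrow> 'l \<Rightarrow> 'l::ab_group_add poly" where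
  "\<omega>t n \<omega> y = (\<Sum>i\<le>n. monom (\<omega> i y) i)"

definition eq_mod_t :: "nat \<Rightarrow> 'l::zero poly \<Rightarrow> 'l poly \<Rightarrow> bool" where
  "eq_mod_t N P Q \<longleftrightarrow> (\<forall>k<N. coeff P k = coeff Q k)"

definition deformation ::
  "nat \<Rightarrow> ('f::field \<Rightarrow> 'l::ab_group_add \<Rightarrow> 'l) \<Rightarrow> ('l \<Rightarrow> 'l \<Rightarrow> 'l) \<Rightarrow> ('l \<Rightarrow> 'l)
     \<Rightarrow> nat \<Rightarrow> (nat \<Rightarrow> 'l \<Rightarrow> 'l \<Rightarrow> 'l) \<Rightarrow> (nat \<Rightarrow> 'l \<Rightarrow> 'l) \<Rightarrow> bool" where
  "deformation p scale br pm n m \<omega> \<longleftrightarrow>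
     m 0 = br \<and> \<omega> 0 = pm \<and>
     (\<forall>i\<in>{1..n}. (m i, \<omega> i) \<in> C2_star p scale br) \<and>
     (\<forall>x y z. eq_mod_t (n + 1)
        (mt n m [:x:] (mt n m [:y:] [:z:]) + mt n m [:y:] (mt n m [:z:] [:x:])
          + mt n m [:z:] (mt n m [:x:] [:y:])) 0) \<and>
     (\<forall>x y. eq_mod_t (n + 1)
        (mt n m [:x:] (\<omega>t n \<omega> y)) (lnorm (mt n m) ([:x:] # replicate p [:y:])))"

definition obs1 ::
  "nat \<Rightarrow> (nat \<Rightarrow> 'l \<Rightarrow> 'l \<Rightarrow> 'l) \<Rightarrow> 'l \<Rightarrow> 'l \<Rightarrow> 'l \<Rightarrow> 'l::ab_group_add" where
  "obs1 n m x y z =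
     - (\<Sum>i=1..n. m i x (m (n + 1 - i) y z) + m i y (m (n + 1 - i) z x) + m i z (m (n + 1 - i) x y))"

text \<open>
  In the second sum the tuple \<open>(i\<^sub>1, \<dots>, i\<^sub>p)\<close> is the list \<open>is\<close>, and
  \<open>fold\<close> applies \<open>m\<^bsub>i\<^sub>1\<^esub>(\<cdot>, y)\<close> first.
\<close>

definition obs2 ::
  "nat \<Rightarrow> nat \<Rightarrow> (nat \<Rightarrow> 'l \<Rightarrow> 'l \<Rightarrow> 'l) \<Rightarrow> (nat \<Rightarrow> 'l \<Rightarrow> 'l) \<Rightarrow> 'l \<Rightarrow> 'l \<Rightarrow> 'l::ab_group_add" where
  "obs2 p n m \<omega> x y =
     (\<Sum>i=1..n. m i x (\<omega> (n + 1 - i) y))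
     - (\<Sum>is | length is = p \<and> set is \<subseteq> {0..n} \<and> sum_list is = n + 1.
          fold (\<lambda>i u. m i u y) is x)"

end

theory Submission
  imports Defs
begin

text \<open>
  Both identities are the coefficient of \<open>t\<^bsup>n+1\<^esup>\<close> in the deformation equations of order
  \<open>n + 1\<close>. The terms not containing the index \<open>n + 1\<close> make up the obstruction; in the
  remaining ones that index occurs exactly once and all other indices are \<open>0\<close>, and these terms
  are the coboundary up to antisymmetry. In the second equation, antisymmetry turns each of the
  \<open>i\<close> outer brackets \<open>[\<cdot>, y]\<close> into \<open>- ad\<^sub>y\<close>, whence the sign \<open>(- 1)\<^sup>i\<close>.
\<close>

section \<open>Coefficients of polynomial extensions\<close>

lemma coeff_funpow_pCons:
  "coeff ((pCons 0 ^^ i) P) k = (if i \<le> k then coeff P (k - i) else 0)"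
  by (induction i arbitrary: k) (auto simp: coeff_pCons split: nat.split)

text \<open>This is the Cauchy product formula. The degree bounds in \<open>bilin_ext\<close> can be
  replaced by \<open>j \<le> k\<close>, because coefficients past the degree are 0 and
  \<open>b\<close> vanishes as soon as one argument does.\<close>

lemma coeff_bilin_ext:
  assumes "\<And>u. b u 0 = 0" and "\<And>v. b 0 v = 0"
  shows "coeff (bilin_ext b P Q) k = (\<Sum>j\<le>k. b (coeff P j) (coeff Q (k - j)))"
proof -
  have inner: "(\<Sum>l\<le>degree Q. coeff (monom (b (coeff P j) (coeff Q l)) (j + l)) k)
      = (if j \<le> k then b (coeff P j) (coeff Q (k - j)) else 0)" (is "?S = _") for j
  proof (cases "j \<le> k")
    case True
    then have "?S = (\<Sum>l\<le>degree Q. if l = k - j then b (coeff P j) (coeff Q l) else 0)"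
      by (intro sum.cong) auto
    also have "\<dots> = b (coeff P j) (coeff Q (k - j))"
      by (auto simp: sum.delta assms coeff_eq_0)
    finally show ?thesis
      using True by simp
  qed auto
  have "coeff (bilin_ext b P Q) k
      = (\<Sum>j\<le>degree P. if j \<le> k then b (coeff P j) (coeff Q (k - j)) else 0)"
    by (simp only: bilin_ext_def coeff_sum inner)
  also have "\<dots> = (\<Sum>j | j \<le> degree P \<and> j \<le> k. b (coeff P j) (coeff Q (k - j)))"
    by (simp flip: sum.inter_filter)
  also have "\<dots> = (\<Sum>j\<le>k. b (coeff P j) (coeff Q (k - j)))"
    by (rule sum.mono_neutral_left) (auto simp: assms intro!: le_degree)
  finally show ?thesis .
qed

text \<open>A constant argument leaves one term of each Cauchy product, and \<open>k \<le> N\<close>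
  guarantees that truncating the family at \<open>N\<close> cuts off nothing. The assumptions stop
  at \<open>N\<close> since later members of a truncated family are arbitrary.\<close>

lemma coeff_mt_const_left:
  assumes "\<And>i u. i \<le> N \<Longrightarrow> m i u 0 = 0" and "\<And>i v. i \<le> N \<Longrightarrow> m i 0 v = 0" and "k \<le> N"
  shows "coeff (mt N m [:x:] Q) k = (\<Sum>i\<le>k. m i x (coeff Q (k - i)))"
proof -
  have *: "coeff (bilin_ext (m i) [:x:] Q) l = m i x (coeff Q l)" if "i \<le> N" for i l
  proof -
    have "coeff (bilin_ext (m i) [:x:] Q) l
        = (\<Sum>j\<le>l. m i (coeff [:x:] j) (coeff Q (l - j)))"
      using that by (intro coeff_bilin_ext) (simp_all add: assms)
    also have "\<dots> = (\<Sum>j\<le>l. if j = 0 then m i x (coeff Q l) else 0)"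
      using that by (intro sum.cong) (auto simp: assms coeff_pCons split: nat.split)
    finally show ?thesis by simp
  qed
  have "coeff (mt N m [:x:] Q) k = (\<Sum>i\<le>N. if i \<le> k then m i x (coeff Q (k - i)) else 0)"
    by (auto simp: mt_def coeff_sum coeff_funpow_pCons * intro!: sum.cong)
  also have "\<dots> = (\<Sum>i\<le>k. m i x (coeff Q (k - i)))"
    using \<open>k \<le> N\<close> by (intro sum.mono_neutral_cong_right) auto
  finally show ?thesis .
qed

lemma coeff_mt_const_right:
  assumes "\<And>i u. i \<le> N \<Longrightarrow> m i u 0 = 0" and "\<And>i v. i \<le> N \<Longrightarrow> m i 0 v = 0" and "k \<le> N"
  shows "coeff (mt N m P [:y:]) k = (\<Sum>i\<le>k. m i (coeff P (k - i)) y)"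
proof -
  have *: "coeff (bilin_ext (m i) P [:y:]) l = m i (coeff P l) y" if "i \<le> N" for i l
  proof -
    have "coeff (bilin_ext (m i) P [:y:]) l
        = (\<Sum>j\<le>l. m i (coeff P j) (coeff [:y:] (l - j)))"
      using that by (intro coeff_bilin_ext) (simp_all add: assms)
    also have "\<dots> = (\<Sum>j\<le>l. if j = l then m i (coeff P l) y else 0)"
      using that by (intro sum.cong) (auto simp: assms coeff_pCons split: nat.split)
    finally show ?thesis by simp
  qed
  have "coeff (mt N m P [:y:]) k = (\<Sum>i\<le>N. if i \<le> k then m i (coeff P (k - i)) y else 0)"
    by (auto simp: mt_def coeff_sum coeff_funpow_pCons * intro!: sum.cong)
  also have "\<dots> = (\<Sum>i\<le>k. m i (coeff P (k - i)) y)"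
    using \<open>k \<le> N\<close> by (intro sum.mono_neutral_cong_right) auto
  finally show ?thesis .
qed

lemma coeff_\<omega>t: "coeff (\<omega>t N \<omega> y) k = (if k \<le> N then \<omega> k y else 0)"
  by (simp add: \<omega>t_def coeff_sum)

section \<open>Iterated products and compositions\<close>

text \<open>Weak compositions of \<open>k\<close> into \<open>q\<close> parts: zero parts are
  allowed.\<close>

definition compositions :: "nat \<Rightarrow> nat \<Rightarrow> nat list set" where
  "compositions q k = {is. length is = q \<and> sum_list is = k}"

lemma finite_compositions: "finite (compositions q k)"
proof (rule finite_subset)
  show "compositions q k \<subseteq> {is. set is \<subseteq> {..k} \<and> length is = q}"
    by (auto simp: compositions_def member_le_sum_list)
qed (simp add: finite_lists_length_eq)

text \<open>The last part is split off, not the first, because \<open>fold\<close> applies it last: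
  it is the index of the outermost product.\<close>

lemma sum_compositions_Suc:
  "(\<Sum>is\<in>compositions (Suc q) k. g is) = (\<Sum>i\<le>k. \<Sum>is\<in>compositions q (k - i). g (is @ [i]))"
proof -
  have "(\<Sum>is\<in>compositions (Suc q) k. g is)
      = (\<Sum>(i, is)\<in>(SIGMA i:{..k}. compositions q (k - i)). g (is @ [i]))"
    by (rule sum.reindex_bij_witness[of _ "\<lambda>(i, is). is @ [i]" "\<lambda>is. (last is, butlast is)"])
      (auto simp: compositions_def length_Suc_conv_rev)
  then show ?thesis
    by (simp add: sum.Sigma finite_compositions)
qed

text \<open>Each further factor \<open>[:y:]\<close> contributes the index of the new outermost
  product; additivity in the left argument moves that product inside the sum over the earlier
  indices.\<close>

lemma coeff_foldl_mt:
  assumes zero: "\<And>i u. i \<le> N \<Longrightarrow> m i u 0 = 0"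
    and add: "\<And>i v. i \<le> N \<Longrightarrow> additive (\<lambda>u. m i u v)" and "k \<le> N"
  shows "coeff (foldl (mt N m) [:x:] (replicate q [:y:])) k
      = (\<Sum>is\<in>compositions q k. fold (\<lambda>i u. m i u y) is x)"
  using \<open>k \<le> N\<close>
proof (induction q arbitrary: k)
  case 0
  have "compositions 0 k = (if k = 0 then {[]} else {})"
    by (auto simp: compositions_def)
  then show ?case
    by (auto simp: coeff_pCons split: nat.split)
next
  case (Suc q)
  have zero': "m i 0 v = 0" if "i \<le> N" for i v
    using additive.zero[OF add[OF that]] .
  have "foldl (mt N m) [:x:] (replicate (Suc q) [:y:])
      = mt N m (foldl (mt N m) [:x:] (replicate q [:y:])) [:y:]"
    by (simp only: replicate_Suc foldl_append foldl.simps flip: replicate_append_same)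
  then have "coeff (foldl (mt N m) [:x:] (replicate (Suc q) [:y:])) k
      = (\<Sum>i\<le>k. m i (\<Sum>is\<in>compositions q (k - i). fold (\<lambda>i u. m i u y) is x) y)"
    using Suc by (simp add: coeff_mt_const_right zero zero')
  also have "\<dots> = (\<Sum>i\<le>k. \<Sum>is\<in>compositions q (k - i). m i (fold (\<lambda>i u. m i u y) is x) y)"
    using Suc.prems by (intro sum.cong refl additive.sum[OF add]) auto
  finally show ?case
    by (simp add: sum_compositions_Suc)
qed

lemma sum_list_eq_0_replicate: "sum_list is = (0::nat) \<Longrightarrow> is = replicate (length is) 0"
  by (intro replicate_eqI) auto

text \<open>If some part is not below \<open>N\<close>, it equals \<open>N\<close> and exhausts the
  sum, so all other parts are 0. Such a tuple is determined by the number \<open>j\<close> of zeros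
  before \<open>N\<close> and the number \<open>i\<close> after it; under \<open>fold\<close> the
  latter are the outer products.\<close>

lemma sum_compositions_split:
  assumes "N > 0"
  shows "(\<Sum>is\<in>compositions q N. g is)
    = (\<Sum>is | length is = q \<and> set is \<subseteq> {0..<N} \<and> sum_list is = N. g is)
      + (\<Sum>(i, j) | i + j + 1 = q. g (replicate j 0 @ N # replicate i 0))"
proof -
  let ?A = "{is. length is = q \<and> set is \<subseteq> {0..<N} \<and> sum_list is = N}"
  let ?I = "{(i, j). i + j + 1 = q}"
  let ?h = "\<lambda>(i, j). replicate j 0 @ N # replicate i 0"
  have inj: "inj_on ?h ?I"
  proof (rule inj_onI)
    fix a b assume "a \<in> ?I" "b \<in> ?I" "?h a = ?h b"
    moreover obtain i j i' j' where ab: "a = (i, j)" "b = (i', j')"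
      by (metis surj_pair)
    ultimately have eq: "replicate j 0 @ N # replicate i 0 = replicate j' 0 @ N # replicate i' 0"
      and sum: "i + j = i' + j'"
      by auto
    \<comment> \<open>The leading zeros recover \<open>j\<close>; since \<open>N > 0\<close>, the
      entry \<open>N\<close> cannot be mistaken for one of them.\<close>
    have "length (takeWhile (\<lambda>a. a = 0) (replicate j 0 @ N # replicate i 0)) = j" for i j :: nat
      using assms by (induction j) auto
    with eq have "j = j'" by metis
    with sum ab show "a = b" by simp
  qed
  have image: "compositions q N - ?A = ?h ` ?I"
  proof (intro set_eqI iffI)
    fix "is" assume "is \<in> compositions q N - ?A"
    then have "\<not> set is \<subseteq> {0..<N}" and len: "length is = q" and sum: "sum_list is = N"
      by (auto simp: compositions_def)
    then obtain a where "a \<in> set is" "a \<ge> N"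
      by (metis atLeastLessThan_iff not_less subsetI zero_le)
    with sum member_le_sum_list[of a "is"] have "N \<in> set is"
      by simp
    then obtain xs ys where xs: "is = xs @ N # ys"
      by (auto simp: in_set_conv_decomp)
    with sum have "sum_list xs = 0" "sum_list ys = 0"
      by auto
    with xs have "is = ?h (length ys, length xs)"
      using sum_list_eq_0_replicate by auto
    moreover have "(length ys, length xs) \<in> ?I"
      using len xs by auto
    ultimately show "is \<in> ?h ` ?I" by blast
  next
    fix "is" assume "is \<in> ?h ` ?I"
    then show "is \<in> compositions q N - ?A"
      by (auto simp: compositions_def sum_list_replicate)
  qed
  have "(\<Sum>is\<in>compositions q N. g is) = sum g (compositions q N - ?A) + sum g ?A"
    by (rule sum.subset_diff[OF _ finite_compositions]) (auto simp: compositions_def)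
  also have "sum g (compositions q N - ?A) = (\<Sum>(i, j)\<in>?I. g (replicate j 0 @ N # replicate i 0))"
    unfolding image sum.reindex[OF inj] by (intro sum.cong) auto
  finally show ?thesis
    by (simp add: add.commute)
qed

section \<open>Alternating bilinear maps\<close>

lemma C2_CE_additive_left:
  assumes "\<phi> \<in> C2_CE scale"
  shows "additive (\<lambda>u. \<phi> u v)"
proof -
  interpret Vector_Spaces.linear scale scale "\<lambda>u. \<phi> u v"
    using assms by (simp add: C2_CE_def)
  show ?thesis by unfold_locales (rule add)
qed

lemma C2_CE_additive_right:
  assumes "\<phi> \<in> C2_CE scale"
  shows "additive (\<phi> u)"
proof -
  interpret Vector_Spaces.linear scale scale "\<phi> u"
    using assms by (simp add: C2_CE_def)
  show ?thesis by unfold_locales (rule add)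
qed

lemma C2_CE_antisym:
  assumes "\<phi> \<in> C2_CE scale"
  shows "\<phi> u v = - \<phi> v u"
proof -
  have "\<phi> (u + v) (u + v) = \<phi> u u + \<phi> u v + (\<phi> v u + \<phi> v v)"
    by (simp add: additive.add[OF C2_CE_additive_left[OF assms]]
        additive.add[OF C2_CE_additive_right[OF assms]] algebra_simps)
  then have "\<phi> u v + \<phi> v u = 0"
    using assms by (simp add: C2_CE_def)
  then show ?thesis by (simp add: add_eq_0_iff2)
qed

text \<open>Passes from the right brackets of \<open>lnorm\<close> to the left brackets of
  \<open>ind2\<close>: each flip costs a sign, and linearity of \<open>br y\<close> carries the
  accumulated sign outward.\<close>

lemma (in lie_algebra) funpow_br_right:
  "((\<lambda>u. br u y) ^^ i) u = scale ((- 1) ^ i) ((br y ^^ i) u)"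
proof (induction i)
  case (Suc i)
  interpret br: Vector_Spaces.linear scale scale "br y"
    using bracket by (simp add: C2_CE_def)
  show ?case
    by (simp add: Suc br.scale C2_CE_antisym[OF bracket, of "scale ((- 1) ^ i) ((br y ^^ i) u)" y])
qed simp

lemma fold_replicate: "fold f (replicate i a) = f a ^^ i"
  by (induction i) (simp_all add: funpow_Suc_right del: funpow.simps(2))

lemma foldl_replicate: "foldl b x (replicate i y) = ((\<lambda>u. b u y) ^^ i) x"
  by (simp add: foldl_conv_fold fold_replicate)

section \<open>The obstruction cochain\<close>

text \<open>Separates the two extreme indices, which will feed the coboundary, from the middle ones,
  which form the obstruction.\<close>

lemma sum_atMost_Suc_split:
  fixes g :: "nat \<Rightarrow> 'a::comm_monoid_add"
  shows "(\<Sum>i\<le>Suc n. g i) = g 0 + (\<Sum>i=1..n. g i) + g (Suc n)"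
  by (simp add: atLeast0AtMost[symmetric] sum.atLeast_Suc_atMost)

theorem proposition3p10:
  fixes p n :: nat
    and scale :: "'f::field \<Rightarrow> 'l::ab_group_add \<Rightarrow> 'l"
    and br :: "'l \<Rightarrow> 'l \<Rightarrow> 'l" and pm :: "'l \<Rightarrow> 'l"
    and m :: "nat \<Rightarrow> 'l \<Rightarrow> 'l \<Rightarrow> 'l" and \<omega> :: "nat \<Rightarrow> 'l \<Rightarrow> 'l"
    and m' :: "'l \<Rightarrow> 'l \<Rightarrow> 'l" and \<omega>' :: "'l \<Rightarrow> 'l"
  assumes "CHAR('f) = p" and "p \<ge> 3"
    and "restricted_lie_algebra p scale br pm"
    and "n \<ge> 1"
    and "deformation p scale br pm n m \<omega>"
    and "(m', \<omega>') \<in> C2_star p scale br"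
    and "deformation p scale br pm (n + 1) (m(n + 1 := m')) (\<omega>(n + 1 := \<omega>'))"
  shows "(obs1 n m, obs2 p n m \<omega>) = d2_star p scale br pm (m', \<omega>')"
proof -
  interpret restricted_lie_algebra p scale br pm by fact
  let ?N = "Suc n"
  define M where "M = m(?N := m')"
  define W where "W = \<omega>(?N := \<omega>')"
  have def: "deformation p scale br pm ?N M W"
    using assms(7) by (simp add: M_def W_def)
  have M0: "M 0 = br" and W0: "W 0 = pm"
    using def by (simp_all add: deformation_def)
  have MN: "M ?N = m'" and WN: "W ?N = \<omega>'"
    by (simp_all add: M_def W_def)
  have Mm: "M i = m i" and W\<omega>: "W i = \<omega> i" if "i \<le> n" for i
    using that by (simp_all add: M_def W_def)
  \<comment> \<open>Index 0 is treated apart: \<open>deformation\<close> imposes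
    \<open>C2_star\<close> only from index 1 on, while \<open>M 0\<close> is the Lie
    bracket.\<close>
  have C2: "M i \<in> C2_CE scale" if "i \<le> ?N" for i
    using def that bracket M0
    by (cases "i = 0") (auto simp: deformation_def C2_star_def)
  then have m'_C2: "m' \<in> C2_CE scale"
    using MN by (metis order_refl)
  have zero: "M i u 0 = 0" "M i 0 v = 0" if "i \<le> ?N" for i u v
    using additive.zero[OF C2_CE_additive_right[OF C2[OF that]]]
      additive.zero[OF C2_CE_additive_left[OF C2[OF that]]] by auto
  have "obs1 n m x y z = d2_CE br m' x y z" for x y z
  proof -
    have coeff: "coeff (mt ?N M [:u:] (mt ?N M [:v:] [:w:])) ?N
        = br u (m' v w) + (\<Sum>i=1..n. m i u (m (?N - i) v w)) + m' u (br v w)" for u v w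
    proof -
      \<comment> \<open>With both arguments constant, only the member of index \<open>k\<close>
        reaches the coefficient of t^k.\<close>
      have inner: "coeff (mt ?N M [:v:] [:w:]) k = M k v w" if "k \<le> ?N" for k
      proof -
        have "coeff (mt ?N M [:v:] [:w:]) k = (\<Sum>i\<le>k. M i v (coeff [:w:] (k - i)))"
          using that by (intro coeff_mt_const_left) (simp_all add: zero)
        also have "\<dots> = (\<Sum>i\<le>k. if i = k then M k v w else 0)"
          using that by (intro sum.cong) (auto simp: zero coeff_pCons split: nat.split)
        finally show ?thesis by simp
      qed
      have "coeff (mt ?N M [:u:] (mt ?N M [:v:] [:w:])) ?N
          = (\<Sum>i\<le>?N. M i u (coeff (mt ?N M [:v:] [:w:]) (?N - i)))"
        by (intro coeff_mt_const_left) (simp_all add: zero)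
      also have "\<dots> = (\<Sum>i\<le>?N. M i u (M (?N - i) v w))"
        by (simp only: inner diff_le_self)
      also have "\<dots> = br u (m' v w) + (\<Sum>i=1..n. M i u (M (?N - i) v w)) + m' u (br v w)"
        by (simp only: sum_atMost_Suc_split M0 MN diff_zero diff_self_eq_0)
      also have "(\<Sum>i=1..n. M i u (M (?N - i) v w)) = (\<Sum>i=1..n. m i u (m (?N - i) v w))"
        by (intro sum.cong) (auto simp: Mm)
      finally show ?thesis .
    qed
    \<comment> \<open>Order \<open>?N\<close> means congruence modulo t to the power
      \<open>?N + 1\<close>, so the coefficient at \<open>?N\<close> is just covered.\<close>
    have "coeff (mt ?N M [:x:] (mt ?N M [:y:] [:z:]) + mt ?N M [:y:] (mt ?N M [:z:] [:x:])
        + mt ?N M [:z:] (mt ?N M [:x:] [:y:])) ?N = 0"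
      using def by (auto simp: deformation_def eq_mod_t_def)
    then have "(\<Sum>i=1..n. m i x (m (n + 1 - i) y z) + m i y (m (n + 1 - i) z x)
        + m i z (m (n + 1 - i) x y))
      + (m' z (br x y) + m' y (br z x) + m' x (br y z)
        + br x (m' y z) + br y (m' z x) + br z (m' x y)) = 0"
      by (simp add: coeff sum.distrib ac_simps)
    then have "obs1 n m x y z = m' z (br x y) + m' y (br z x) + m' x (br y z)
        + br x (m' y z) + br y (m' z x) + br z (m' x y)"
      by (simp only: obs1_def add_eq_0_iff)
    \<comment> \<open>The cyclic Jacobi terms are brought to the argument order of
      \<open>d2_CE\<close>. The term \<open>m' y (br z x)\<close> changes sign twice, once by
      swapping the arguments of \<open>m'\<close> and once by turning \<open>br z x\<close> into
      \<open>- br x z\<close>.\<close>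
    also have "\<dots> = d2_CE br m' x y z"
      using C2_CE_antisym[OF m'_C2, of z "br x y"] C2_CE_antisym[OF m'_C2, of y "br z x"]
        C2_CE_antisym[OF m'_C2, of x "br y z"] C2_CE_antisym[OF m'_C2, of z x]
        C2_CE_antisym[OF bracket, of z x]
        additive.minus[OF C2_CE_additive_right[OF bracket], of y "m' x z"]
        additive.minus[OF C2_CE_additive_left[OF m'_C2], of "br x z" y]
      by (simp add: d2_CE_def)
    finally show ?thesis .
  qed
  moreover have "obs2 p n m \<omega> x y = ind2 p scale br pm (m', \<omega>') x y" for x y
  proof -
    let ?A = "{is. length is = p \<and> set is \<subseteq> {0..n} \<and> sum_list is = n + 1}"
    have "coeff (mt ?N M [:x:] (\<omega>t ?N W y)) ?N = (\<Sum>i\<le>?N. M i x (W (?N - i) y))"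
      by (simp add: coeff_mt_const_left zero coeff_\<omega>t del: sum.atMost_Suc)
    \<comment> \<open>The extreme indices \<open>0\<close> and \<open>?N\<close> give the two terms
      that \<open>ind2\<close> subtracts.\<close>
    also have "\<dots> = br x (\<omega>' y) + (\<Sum>i=1..n. M i x (W (?N - i) y)) + m' x (pm y)"
      by (simp only: sum_atMost_Suc_split M0 MN W0 WN diff_zero diff_self_eq_0)
    also have "(\<Sum>i=1..n. M i x (W (?N - i) y)) = (\<Sum>i=1..n. m i x (\<omega> (?N - i) y))"
      by (intro sum.cong) (auto simp: Mm W\<omega>)
    finally have lhs: "coeff (mt ?N M [:x:] (\<omega>t ?N W y)) ?N
        = br x (\<omega>' y) + (\<Sum>i=1..n. m i x (\<omega> (?N - i) y)) + m' x (pm y)" .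
    have "coeff (lnorm (mt ?N M) ([:x:] # replicate p [:y:])) ?N
        = (\<Sum>is\<in>compositions p ?N. fold (\<lambda>i u. M i u y) is x)"
      by (simp add: lnorm_def coeff_foldl_mt zero C2_CE_additive_left[OF C2])
    also have "\<dots> = (\<Sum>is\<in>?A. fold (\<lambda>i u. M i u y) is x)
        + (\<Sum>(i, j) | i + j + 1 = p. fold (\<lambda>i u. M i u y) (replicate j 0 @ ?N # replicate i 0) x)"
      by (simp add: sum_compositions_split atLeastLessThanSuc_atLeastAtMost)
    \<comment> \<open>Tuples in \<open>?A\<close> have entries at most \<open>n\<close>, where the
      extended family agrees with \<open>m\<close>.\<close>
    also have "(\<Sum>is\<in>?A. fold (\<lambda>i u. M i u y) is x) = (\<Sum>is\<in>?A. fold (\<lambda>i u. m i u y) is x)"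
      by (intro sum.cong fold_cong refl) (auto simp: Mm)
    \<comment> \<open>Subtraction on \<open>nat\<close> is truncated, so the two sets agree only for
      positive \<open>p\<close>.\<close>
    also have "{(i, j). i + j + 1 = p} = {(i, j). i + j = p - 1}"
      using \<open>p \<ge> 3\<close> by auto
    \<comment> \<open>The \<open>j\<close> zeros before \<open>?N\<close> build
      \<open>lnorm br (x # replicate j y)\<close>, the entry \<open>?N\<close> applies
      \<open>m'\<close> with second argument \<open>y\<close>, and the \<open>i\<close> zeros after
      it become signed powers of \<open>br y\<close>.\<close>
    also have "(\<Sum>(i, j) | i + j = p - 1.
          fold (\<lambda>i u. M i u y) (replicate j 0 @ ?N # replicate i 0) x)
        = (\<Sum>(i, j) | i + j = p - 1.
          scale ((- 1) ^ i) ((br y ^^ i) (m' (lnorm br (x # replicate j y)) y)))"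
      by (simp add: fold_replicate lnorm_def foldl_replicate M0 MN funpow_br_right)
    \<comment> \<open>The restrictedness congruence at the coefficient \<open>?N\<close> equates the
      two expansions. Collecting the terms with \<open>m'\<close> and \<open>\<omega>'\<close> on
      one side leaves \<open>obs2\<close> on the other.\<close>
    finally have "br x (\<omega>' y) + (\<Sum>i=1..n. m i x (\<omega> (?N - i) y)) + m' x (pm y)
        = (\<Sum>is\<in>?A. fold (\<lambda>i u. m i u y) is x) + (\<Sum>(i, j) | i + j = p - 1.
          scale ((- 1) ^ i) ((br y ^^ i) (m' (lnorm br (x # replicate j y)) y)))"
      using def unfolding lhs[symmetric] by (simp add: deformation_def eq_mod_t_def)
    then show ?thesis
      by (simp add: obs2_def ind2_def algebra_simps)
  qed
  ultimately show ?thesis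
    by (simp add: d2_star_def fun_eq_iff)
qed

end
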